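(* Let $j\in\{1,\ldots,J\}$ be fixed, let $I\subset\mathbb{R}$ be an arbitrary subset, and let $n_j$, $n_j'$ be given such that $n_j(\omega)\ne0$ for every $\omega\in I$ and such that there exists a value $\omega_0\in I\setminus\{0\}$ with $\operatorname{Im}(n_j'(\omega_0))>0$. Assume that $S_j=(\rho_j,\nu_j,\nu_j',\zeta_j,\zeta_j',Z_j,Z_j')$ and $\tilde S_j=(\tilde\rho_j,\tilde\nu_j,\tilde\nu_j',\tilde\zeta_j,\tilde\zeta_j',\tilde Z_j,\tilde Z_j')$ are two parameter tuples with $$ M_j[S_j](\omega,\delta)=M_j[\tilde S_j](\omega,\delta)\quad\text{for all }\omega\in I,\ \delta\in\mathbb{R}. $$ Additionally, assume $Z_j<\zeta_j$ and $\tilde Z_j<\tilde\zeta_j$, and $Z_j'>\zeta_j'>0$ and $\tilde Z_j'>\tilde\zeta_j'>0$. Moreover, assume that there exists an element $\omega_1\in I$ with $$ \frac{n_j'(\omega_1)}{n_j(\omega_1)}\ne\frac{\nu_j'(\omega_1)}{\nu_j(\omega_1)}. $$ Then $S_j=\tilde S_j$, that is, $\rho_j=\tilde\rho_j$, $\zeta_j=\tilde\zeta_j$, $\zeta_j'=\tilde\zeta_j'$, $Z_j=\tilde Z_j$, $Z_j'=\tilde Z_j'$, and $\nu_j(\omega)=\tilde\nu_j(\omega)$, $\nu_j'(\omega)=\tilde\nu_j'(\omega)$ for all $\omega\in I$.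
   Context: Let $c>0$ denote the speed of light, let $J$ be the number of layers, and let $\mathbb{H}=\{z\in\mathbb{C}\mid\operatorname{Im}z>0\}$. Primes do not denote derivatives in $\omega$; primed quantities are independent parameters (rates of change under compression). The functions $n_j:\mathbb{R}\to\mathbb{H}$ (refractive index of the $j$-th layer) and $n_j':\mathbb{R}\to\mathbb{C}$ are known. A parameter tuple $S_j=(\rho_j,\nu_j,\nu_j',\zeta_j,\zeta_j',Z_j,Z_j')$ consists of: - a number $\rho_j>0$ (particles per surface area), - functions $\nu_j:\mathbb{R}\to\mathbb{H}$ and $\nu_j':\mathbb{R}\to\mathbb{C}$, where $\nu_j(\omega)=\sqrt{1+\check\chi_j^{(\mathrm p)}(\omega)}$ is the refractive index of the particles, $\check\chi_j^{(\mathrm p)}(\omega)=\int_{\mathbb{R}}\chi_j^{(\mathrm p)}(t)e^{i\omega t}\,dt$, $\chi_j^{(\mathrm p)}:\mathbb{R}\to\mathbb{R}$ is the susceptibility of the particles, and the square root is taken with values in $\mathbb{H}$, - real numbers $\zeta_j,\zeta_j',Z_j,Z_j'$. For $\delta\in\mathbb{R}$ set $$\bar n_j(\omega,\delta)=n_j(\omega)+\delta n_j'(\omega),\quad \bar\nu_j(\omega,\delta)=\nu_j(\omega)+\delta\nu_j'(\omega),\quad \bar\zeta_j(\delta)=\zeta_j+\delta\zeta_j',\quad \bar Z_j(\delta)=Z_j+\delta Z_j',$$ and define the data $$ M_j[S_j](\omega,\delta)=\rho_j\bigl(\bar\nu_j^2(\omega,\delta)-\bar n_j^2(\omega,\delta)\bigr)\Bigl(e^{-i\frac{\omega}{2c}\bar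 n_j(\omega,\delta)(\bar\zeta_j(\delta)+3\bar Z_j(\delta))}-e^{-i\frac{\omega}{2c}\bar n_j(\omega,\delta)(3\bar\zeta_j(\delta)+\bar Z_j(\delta))}\Bigr). $$ The quantities with a tilde define $M_j[\tilde S_j]$ by the same formula, with the same $n_j,n_j'$.
   Formalization: Corrected, since the data vanish at ω=0 and may vanish at ω₀: ω₁ is taken in I∖{0}, ν_j and ν_j' are identified only on I∖{0}, and ω₀ must also satisfy (ν_j(ω₀),ν_j'(ω₀)) ≠ (n_j(ω₀),n_j'(ω₀)). *)

theory Defs
  imports "HOL-Analysis.Analysis"
begin

definition upper_half_plane :: "complex set" where
  "upper_half_plane = {z. Im z > 0}"

definition fourier :: "(real \<Rightarrow> real) \<Rightarrow> real \<Rightarrow> complex" where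
  "fourier chi \<omega> = (LINT t|lborel. complex_of_real (chi t) * exp (\<i> * complex_of_real (\<omega> * t)))"

(* Primed fields are independent parameters (rates of change under compression), not derivatives. *)
record layer_params =
  rho :: real
  nu :: "real \<Rightarrow> complex"
  nu' :: "real \<Rightarrow> complex"
  zeta :: real
  zeta' :: real
  Zc :: real
  Zc' :: real

(* Every complex number has at most one square root in the open upper half-plane (and none iff
   it is a nonnegative real), so the two pointwise conditions on nu say exactly that nu is the
   upper half-plane valued square root of 1 + fourier chi. *)
definition layer_params_valid :: "layer_params \<Rightarrow> bool" where
  "layer_params_valid S \<longleftrightarrow>
     rho S > 0 \<and>
     (\<exists>chi :: real \<Rightarrow> real. integrable lborel chi \<and>
        (\<forall>\<omega>. nu S \<omega> \<in> upper_half_plane \<and> (nu S \<omega>)\<^sup>2 = 1 + fourier chi \<omega>))"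

definition n_bar :: "(real \<Rightarrow> complex) \<Rightarrow> (real \<Rightarrow> complex) \<Rightarrow> real \<Rightarrow> real \<Rightarrow> complex" where
  "n_bar n n' \<omega> \<delta> = n \<omega> + complex_of_real \<delta> * n' \<omega>"

definition nu_bar :: "layer_params \<Rightarrow> real \<Rightarrow> real \<Rightarrow> complex" where
  "nu_bar S \<omega> \<delta> = nu S \<omega> + complex_of_real \<delta> * nu' S \<omega>"

definition zeta_bar :: "layer_params \<Rightarrow> real \<Rightarrow> real" where
  "zeta_bar S \<delta> = zeta S + \<delta> * zeta' S"

definition Z_bar :: "layer_params \<Rightarrow> real \<Rightarrow> real" where
  "Z_bar S \<delta> = Zc S + \<delta> * Zc' S"

definition layer_data ::
  "real \<Rightarrow> (real \<Rightarrow> complex) \<Rightarrow> (real \<Rightarrow> complex) \<Rightarrow> layer_params \<Rightarrow> real \<Rightarrow> real \<Rightarrow> complex" where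
  "layer_data c n n' S \<omega> \<delta> =
     complex_of_real (rho S) * ((nu_bar S \<omega> \<delta>)\<^sup>2 - (n_bar n n' \<omega> \<delta>)\<^sup>2) *
     (exp (- \<i> * complex_of_real (\<omega> / (2 * c)) * n_bar n n' \<omega> \<delta> *
           complex_of_real (zeta_bar S \<delta> + 3 * Z_bar S \<delta>))
      - exp (- \<i> * complex_of_real (\<omega> / (2 * c)) * n_bar n n' \<omega> \<delta> *
           complex_of_real (3 * zeta_bar S \<delta> + Z_bar S \<delta>)))"

end

theory Submission
  imports Defs "HOL-Computational_Algebra.Polynomial"
begin

text \<open>
  For fixed \<open>\<omega>\<close> the data are, as a function of \<open>\<delta>\<close>, an amplitude polynomial times a difference of
  two exponentials of polynomials in \<open>\<delta>\<close> of degree at most two. Exponentials of polynomials whose pairwise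
  differences are non-constant are linearly independent over the polynomials
  (\<open>exp_poly_independent\<close>), so amplitudes and exponents can be read off separately.

  At \<open>\<omega>\<^sub>0\<close> the amplitude does not vanish: otherwise \<open>\<nu> + \<delta> \<nu>'\<close> would be \<open>n + \<delta> n'\<close> up to a sign,
  and the upper half-plane excludes the minus sign (\<open>amplitude_nonzero\<close>). Since
  \<open>n'(\<omega>\<^sub>0) \<noteq> 0\<close>, the two exponents determine the unordered pair of affine functions \<open>\<zeta> + 3 Z\<close>, \<open>3 \<zeta> + Z\<close> of \<open>\<delta>\<close>. Which is which is decided by
  the slopes, because \<open>Z' > \<zeta>'\<close> makes the first one steeper (\<open>exponents_determined\<close>). This gives
  \<open>\<zeta>, \<zeta>', Z, Z'\<close>.

  With equal exponents, the amplitudes \<open>\<rho> (\<nu>\<^sup>2 - n\<^sup>2)\<close> of the two tuples agree as polynomials in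
  \<open>\<delta>\<close> at every \<open>\<omega> \<noteq> 0\<close> in \<open>I\<close> (\<open>amplitude_determined\<close>). If the densities \<open>\<rho>\<close>
  were different, the square of the second particle index would be a combination, with nonzero
  coefficients, of the squares of \<open>\<nu> + \<delta> \<nu>'\<close> and \<open>n + \<delta> n'\<close>; at \<open>\<omega>\<^sub>1\<close> these affine
  polynomials are linearly independent, and such a combination has nonzero discriminant
  (\<open>density_determined\<close>). So the densities agree, hence so do the squares of the particle indices,
  and the sign is fixed by the upper half-plane (\<open>affine_square_determined\<close>).
\<close>

section \<open>Linear independence of exponentials of polynomials\<close>

text \<open>The action of differentiation on \<open>p\<close> in the product \<open>p e\<^sup>r\<close>.\<close>

definition twisted_pderiv :: "complex poly \<Rightarrow> complex poly \<Rightarrow> complex poly" where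
  "twisted_pderiv r p = pderiv p + pderiv r * p"

lemma has_vector_derivative_poly_exp:
  "((\<lambda>x::real. poly p (of_real x) * exp (poly r (of_real x)))
     has_vector_derivative poly (twisted_pderiv r p) (of_real x) * exp (poly r (of_real x))) (at x)"
proof (rule has_vector_derivative_real_field)
  show "((\<lambda>z. poly p z * exp (poly r z)) has_field_derivative
      poly (twisted_pderiv r p) (of_real x) * exp (poly r (of_real x))) (at (of_real x))"
    unfolding twisted_pderiv_def
    by (auto intro!: derivative_eq_intros simp: algebra_simps)
qed

text \<open>A nonzero solution of \<open>p' = - r' p\<close> would divide its own derivative and hence be constant.\<close>

lemma twisted_pderiv_eq_0_iff:
  assumes "degree r \<noteq> 0"
  shows "twisted_pderiv r p = 0 \<longleftrightarrow> p = 0"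
proof
  assume "twisted_pderiv r p = 0"
  then have eq: "pderiv p = p * (- pderiv r)"
    by (simp add: twisted_pderiv_def add_eq_0_iff2 mult.commute)
  then have "p dvd pderiv p"
    by (rule dvdI)
  then have "pderiv p = 0"
    using not_dvd_pderiv pderiv_eq_0_iff by blast
  moreover have "pderiv r \<noteq> 0"
    using assms by (simp add: pderiv_eq_0_iff)
  ultimately show "p = 0"
    using eq by auto
qed (simp add: twisted_pderiv_def)

lemma funpow_twisted_pderiv_eq_0_iff:
  assumes "degree r \<noteq> 0"
  shows "(twisted_pderiv r ^^ m) p = 0 \<longleftrightarrow> p = 0"
  by (induction m) (simp_all add: twisted_pderiv_eq_0_iff[OF assms])

lemma funpow_pderiv_eq_0:
  fixes p :: "'a :: field_char_0 poly"
  assumes "degree p < m"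
  shows "(pderiv ^^ m) p = 0"
proof -
  have "degree ((pderiv ^^ k) p) = degree p - k" for k
    by (induction k) (simp_all add: degree_pderiv)
  then have "degree ((pderiv ^^ (m - 1)) p) = 0"
    using assms by simp
  then have "pderiv ((pderiv ^^ (m - 1)) p) = 0"
    by (simp add: pderiv_eq_0_iff)
  with assms show ?thesis
    by (cases m) simp_all
qed

lemma poly_of_real_eq_0:
  fixes p :: "complex poly"
  assumes "\<And>x::real. poly p (of_real x) = 0"
  shows "p = 0"
proof (rule ccontr)
  assume "p \<noteq> 0"
  then have "finite {z. poly p z = 0}"
    by (rule poly_roots_finite)
  moreover have "range complex_of_real \<subseteq> {z. poly p z = 0}"
    using assms by auto
  ultimately have "finite (range complex_of_real)"
    by (rule rev_finite_subset)
  then show False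
    by (simp add: finite_image_iff inj_of_real infinite_UNIV_char_0)
qed

text \<open>
  Dividing by one of the exponentials and differentiating more often than the degree of its
  coefficient removes that term. The other coefficients undergo twisted differentiations, which are
  injective, so the number of terms goes down by one without losing information.
\<close>

lemma exp_poly_independent:
  fixes p q :: "'k \<Rightarrow> complex poly"
  assumes "finite K"
    and "\<And>i j. i \<in> K \<Longrightarrow> j \<in> K \<Longrightarrow> i \<noteq> j \<Longrightarrow> degree (q i - q j) \<noteq> 0"
    and "\<And>x::real. (\<Sum>i\<in>K. poly (p i) (of_real x) * exp (poly (q i) (of_real x))) = 0"
    and "i \<in> K"
  shows "p i = 0"
  using assms
proof (induction K arbitrary: p q i rule: finite_induct)
  case empty
  then show ?case by simp
next
  case (insert k K)
  define r where "r j = q j - q k" for j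
  have iterate:
    "(\<Sum>j\<in>insert k K. poly ((twisted_pderiv (r j) ^^ m) (p j)) (of_real x)
        * exp (poly (r j) (of_real x))) = 0" for m and x :: real
  proof (induction m arbitrary: x)
    case 0
    have "(\<Sum>j\<in>insert k K. poly (p j) (of_real x) * exp (poly (r j) (of_real x)))
        = (\<Sum>j\<in>insert k K. poly (p j) (of_real x) * exp (poly (q j) (of_real x)))
          * exp (- poly (q k) (of_real x))"
      unfolding sum_distrib_right r_def
      by (intro sum.cong refl) (simp add: exp_diff exp_minus field_simps)
    then show ?case
      using insert.prems(2)[of x] by simp
  next
    case (Suc m)
    let ?f = "\<lambda>x::real. \<Sum>j\<in>insert k K. poly ((twisted_pderiv (r j) ^^ m) (p j)) (of_real x)
        * exp (poly (r j) (of_real x))"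
    have "(?f has_vector_derivative
        (\<Sum>j\<in>insert k K. poly (twisted_pderiv (r j) ((twisted_pderiv (r j) ^^ m) (p j))) (of_real x)
           * exp (poly (r j) (of_real x)))) (at x)"
      by (rule has_vector_derivative_sum) (rule has_vector_derivative_poly_exp)
    moreover have "?f = (\<lambda>_. 0)"
      using Suc.IH by (intro ext)
    then have "(?f has_vector_derivative 0) (at x)"
      by simp
    ultimately show ?case
      by (simp only: funpow.simps comp_def) (rule vector_derivative_unique_at)
  qed
  have rdeg: "degree (r j) \<noteq> 0" if "j \<in> K" for j
    unfolding r_def using insert.prems(1) insert.hyps that by auto
  define m where "m = Suc (degree (p k))"
  have "twisted_pderiv (r k) = pderiv"
    by (intro ext) (simp add: twisted_pderiv_def r_def)
  then have "(twisted_pderiv (r k) ^^ m) (p k) = 0"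
    by (simp add: funpow_pderiv_eq_0 m_def del: funpow.simps)
  then have sumK:
    "(\<Sum>j\<in>K. poly ((twisted_pderiv (r j) ^^ m) (p j)) (of_real x)
        * exp (poly (r j) (of_real x))) = 0" for x :: real
    using iterate[of m x] insert.hyps by simp
  have "degree (r a - r b) \<noteq> 0" if "a \<in> K" "b \<in> K" "a \<noteq> b" for a b
    using insert.prems(1)[of a b] that by (simp add: r_def)
  then have "(twisted_pderiv (r j) ^^ m) (p j) = 0" if "j \<in> K" for j
    using insert.IH[of r "\<lambda>j. (twisted_pderiv (r j) ^^ m) (p j)" j] sumK that by blast
  then have pK: "p j = 0" if "j \<in> K" for j
    using funpow_twisted_pderiv_eq_0_iff[OF rdeg] that by blast
  have "poly (p k) (of_real x) = 0" for x :: real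
    using insert.prems(2)[of x] insert.hyps pK by simp
  then have "p k = 0"
    by (rule poly_of_real_eq_0)
  with pK insert.prems(3) show ?case
    by auto
qed

section \<open>Exponents and amplitudes of the layer data\<close>

text \<open>
  The pair \<open>w\<close> holds the value at \<open>0\<close> and the slope of a real affine function of \<open>\<delta>\<close>; the prefactor
  is \<open>\<kappa> = - \<i> \<omega> / (2 c)\<close>, and \<open>a\<close>, \<open>a'\<close> stand for \<open>n(\<omega>)\<close>, \<open>n'(\<omega>)\<close>.
\<close>

definition phase :: "complex \<Rightarrow> complex \<Rightarrow> complex \<Rightarrow> real \<times> real \<Rightarrow> complex poly" where
  "phase \<kappa> a a' w = smult \<kappa> ([:a, a':] * [:of_real (fst w), of_real (snd w):])"

definition amplitude :: "real \<Rightarrow> complex \<Rightarrow> complex \<Rightarrow> complex \<Rightarrow> complex \<Rightarrow> complex poly" where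
  "amplitude \<rho> v v' a a' = smult (of_real \<rho>) ([:v, v':]\<^sup>2 - [:a, a':]\<^sup>2)"

lemma layer_data_eq_exp_poly:
  "layer_data c n n' S \<omega> \<delta> =
    (let \<kappa> = - \<i> * complex_of_real (\<omega> / (2 * c));
         p = amplitude (rho S) (nu S \<omega>) (nu' S \<omega>) (n \<omega>) (n' \<omega>) in
     poly p (of_real \<delta>) *
       (exp (poly (phase \<kappa> (n \<omega>) (n' \<omega>) (zeta S + 3 * Zc S, zeta' S + 3 * Zc' S)) (of_real \<delta>))
      - exp (poly (phase \<kappa> (n \<omega>) (n' \<omega>) (3 * zeta S + Zc S, 3 * zeta' S + Zc' S)) (of_real \<delta>))))"
proof -
  have phase: "poly (phase \<kappa> a a' w) (of_real \<delta>)
      = \<kappa> * (a + of_real \<delta> * a') * of_real (fst w + \<delta> * snd w)" for \<kappa> a a' w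
    by (simp add: phase_def algebra_simps)
  have "(zeta S + 3 * Zc S) + \<delta> * (zeta' S + 3 * Zc' S) = zeta_bar S \<delta> + 3 * Z_bar S \<delta>"
    "(3 * zeta S + Zc S) + \<delta> * (3 * zeta' S + Zc' S) = 3 * zeta_bar S \<delta> + Z_bar S \<delta>"
    by (simp_all add: zeta_bar_def Z_bar_def algebra_simps)
  moreover have "poly (amplitude (rho S) (nu S \<omega>) (nu' S \<omega>) (n \<omega>) (n' \<omega>)) (of_real \<delta>)
      = of_real (rho S) * ((nu_bar S \<omega> \<delta>)\<^sup>2 - (n_bar n n' \<omega> \<delta>)\<^sup>2)"
    by (simp add: amplitude_def nu_bar_def n_bar_def)
  ultimately show ?thesis
    unfolding layer_data_def Let_def phase fst_conv snd_conv by (simp only: n_bar_def)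
qed

lemma degree_phase_diff:
  assumes "\<kappa> \<noteq> 0" "w \<noteq> u" "a' \<noteq> 0 \<or> a \<noteq> 0 \<and> snd w \<noteq> snd u"
  shows "degree (phase \<kappa> a a' w - phase \<kappa> a a' u) \<noteq> 0"
proof -
  have factored: "phase \<kappa> a a' w - phase \<kappa> a a' u
      = smult \<kappa> ([:a, a':] * [:of_real (fst w - fst u), of_real (snd w - snd u):])"
    by (simp add: phase_def algebra_simps)
  have "[:a, a':] \<noteq> 0"
    using assms(3) by auto
  moreover have "[:of_real (fst w - fst u), of_real (snd w - snd u):] \<noteq> (0 :: complex poly)"
    using assms(2) by (auto simp: prod_eq_iff)
  ultimately show ?thesis
    unfolding factored using assms by (auto simp: degree_mult_eq)
qed

text \<open>
  Collecting the four terms by their exponents, no exponential with nonzero amplitude may remain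
  uncancelled, so the two pairs of exponents agree up to order; the order is fixed by the slopes.
\<close>

lemma exponents_determined:
  assumes "\<kappa> \<noteq> 0" "a' \<noteq> 0" "p \<noteq> 0"
    and slope: "snd A > snd B" "snd A' > snd B'"
    and eq: "\<And>x::real.
      poly p (of_real x) * (exp (poly (phase \<kappa> a a' A) (of_real x)) - exp (poly (phase \<kappa> a a' B) (of_real x)))
    = poly p' (of_real x) * (exp (poly (phase \<kappa> a a' A') (of_real x)) - exp (poly (phase \<kappa> a a' B') (of_real x)))"
  shows "A = A'" "B = B'"
proof -
  define K where "K = {A, B, A', B'}"
  define coeff where "coeff w = (if w = A then p else 0) - (if w = B then p else 0)
      - (if w = A' then p' else 0) + (if w = B' then p' else 0)" for w
  have fin: "finite K"
    by (simp add: K_def)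
  have mem: "A \<in> K" "B \<in> K" "A' \<in> K" "B' \<in> K"
    by (simp_all add: K_def)
  have "(\<Sum>w\<in>K. poly (coeff w) (of_real x) * exp (poly (phase \<kappa> a a' w) (of_real x))) = 0"
    for x :: real
  proof -
    let ?E = "\<lambda>w. exp (poly (phase \<kappa> a a' w) (of_real x))"
    have single: "(\<Sum>w\<in>K. poly (if w = u then f else 0) (of_real x) * ?E w) = poly f (of_real x) * ?E u"
      if "u \<in> K" for u f
    proof -
      have "(\<Sum>w\<in>K. poly (if w = u then f else 0) (of_real x) * ?E w)
          = (\<Sum>w\<in>K. if w = u then poly f (of_real x) * ?E w else 0)"
        by (intro sum.cong) auto
      then show ?thesis
        using that fin by simp
    qed
    show ?thesis
      unfolding coeff_def poly_add poly_diff distrib_right left_diff_distrib sum.distrib sum_subtractf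
      using eq[of x] by (simp add: single mem right_diff_distrib)
  qed
  then have zero: "coeff w = 0" if "w \<in> K" for w
    using exp_poly_independent[of K "phase \<kappa> a a'" coeff w] fin that
      degree_phase_diff[of \<kappa> _ _ a' a] assms(1,2) by blast
  have "coeff A = 0" "coeff B = 0" "coeff A' = 0"
    by (simp_all add: zero mem)
  moreover have "A \<noteq> B" "A' \<noteq> B'"
    using slope by auto
  moreover have "\<not> (A = B' \<and> A' = B)"
    using slope by auto
  ultimately show "A = A'" "B = B'"
    using \<open>p \<noteq> 0\<close> unfolding coeff_def by (auto split: if_splits)
qed

text \<open>
  The difference of the two exponents is \<open>\<kappa> (a + \<delta> a')\<close> times an affine function of nonzero slope,
  hence non-constant even if \<open>a' = 0\<close>, and the two exponentials are independent.
\<close>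

lemma amplitude_determined:
  assumes "\<kappa> \<noteq> 0" "a \<noteq> 0" "snd A \<noteq> snd B"
    and eq: "\<And>x::real.
      poly p (of_real x) * (exp (poly (phase \<kappa> a a' A) (of_real x)) - exp (poly (phase \<kappa> a a' B) (of_real x)))
    = poly p' (of_real x) * (exp (poly (phase \<kappa> a a' A) (of_real x)) - exp (poly (phase \<kappa> a a' B) (of_real x)))"
  shows "p = p'"
proof -
  define coeff where "coeff w = (if w = A then p - p' else p' - p)" for w
  have "A \<noteq> B"
    using assms(3) by auto
  then have "(\<Sum>w\<in>{A, B}. poly (coeff w) (of_real x) * exp (poly (phase \<kappa> a a' w) (of_real x))) = 0"
    for x :: real
    using eq[of x] by (simp add: coeff_def algebra_simps)
  moreover have "degree (phase \<kappa> a a' w - phase \<kappa> a a' u) \<noteq> 0"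
    if "w \<in> {A, B}" "u \<in> {A, B}" "w \<noteq> u" for w u
    using degree_phase_diff[of \<kappa> w u a' a] that assms by auto
  ultimately have "coeff A = 0"
    using exp_poly_independent[of "{A, B}" "phase \<kappa> a a'" coeff A] by blast
  then show ?thesis
    by (simp add: coeff_def)
qed

section \<open>Recovering the density and the particle index\<close>

lemma amplitude_eq_iff:
  "amplitude \<rho> v v' a a' = amplitude \<sigma> u u' a a' \<longleftrightarrow>
     of_real \<rho> * (v\<^sup>2 - a\<^sup>2) = of_real \<sigma> * (u\<^sup>2 - a\<^sup>2) \<and>
     of_real \<rho> * (v * v' - a * a') = of_real \<sigma> * (u * u' - a * a') \<and>
     of_real \<rho> * (v'\<^sup>2 - a'\<^sup>2) = of_real \<sigma> * (u'\<^sup>2 - a'\<^sup>2)"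
proof -
  have expand: "amplitude \<rho> v v' a a' =
      [:of_real \<rho> * (v\<^sup>2 - a\<^sup>2), 2 * (of_real \<rho> * (v * v' - a * a')), of_real \<rho> * (v'\<^sup>2 - a'\<^sup>2):]"
    for \<rho> v v'
    by (simp add: amplitude_def power2_eq_square algebra_simps)
  show ?thesis
    unfolding expand by simp
qed

text \<open>
  The discriminant of \<open>\<sigma> (u + \<delta> u')\<^sup>2 = \<rho> (v + \<delta> v')\<^sup>2 - (\<rho> - \<sigma>) (a + \<delta> a')\<^sup>2\<close> vanishes by
  the left-hand side and is a multiple of \<open>\<rho> (\<rho> - \<sigma>) (v a' - a v')\<^sup>2\<close> by the right-hand side.
\<close>

lemma density_determined:
  assumes "amplitude \<rho> v v' a a' = amplitude \<sigma> u u' a a'"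
    and "\<rho> \<noteq> 0" "v * a' \<noteq> a * v'"
  shows "\<rho> = \<sigma>"
proof -
  define d where "d = complex_of_real \<rho> - of_real \<sigma>"
  have square:
    "of_real \<sigma> * u\<^sup>2 = of_real \<rho> * v\<^sup>2 - d * a\<^sup>2"
    "of_real \<sigma> * (u * u') = of_real \<rho> * (v * v') - d * (a * a')"
    "of_real \<sigma> * u'\<^sup>2 = of_real \<rho> * v'\<^sup>2 - d * a'\<^sup>2"
    using assms(1) unfolding amplitude_eq_iff d_def by (auto simp: algebra_simps)
  have "(of_real \<sigma> * (u * u'))\<^sup>2 = (of_real \<sigma> * u\<^sup>2) * (of_real \<sigma> * u'\<^sup>2)"
    by (simp add: power2_eq_square)
  then have "of_real \<rho> * d * (v * a' - a * v')\<^sup>2 = 0"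
    unfolding square by (simp add: power2_eq_square algebra_simps)
  then have "d = 0"
    using assms(2,3) by simp
  then show ?thesis
    by (simp add: d_def)
qed

lemma upper_half_plane_nonzero: "z \<in> upper_half_plane \<Longrightarrow> z \<noteq> 0"
  by (auto simp: upper_half_plane_def)

lemma affine_square_determined:
  assumes "v\<^sup>2 = u\<^sup>2" "v * v' = u * u'" "v \<in> upper_half_plane" "u \<in> upper_half_plane"
  shows "v = u" "v' = u'"
proof -
  show "v = u"
    using assms by (auto simp: power2_eq_iff upper_half_plane_def)
  then show "v' = u'"
    using assms upper_half_plane_nonzero by auto
qed

lemma amplitude_nonzero:
  assumes "\<rho> \<noteq> 0" "v \<in> upper_half_plane" "a \<in> upper_half_plane" "(v, v') \<noteq> (a, a')"
  shows "amplitude \<rho> v v' a a' \<noteq> 0"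
proof
  assume "amplitude \<rho> v v' a a' = 0"
  then have "amplitude \<rho> v v' a a' = amplitude \<rho> a a' a a'"
    by (simp add: amplitude_def)
  then show False
    using affine_square_determined[of v a v' a'] assms unfolding amplitude_eq_iff by simp
qed

section \<open>Uniqueness of the layer parameters\<close>

theorem lemma5p2:
  fixes c :: real and J j :: nat and I :: "real set"
    and n n' :: "nat \<Rightarrow> real \<Rightarrow> complex"
    and S T :: "nat \<Rightarrow> layer_params"
  assumes "c > 0"
    and "j \<in> {1..J}"
    and "\<forall>\<omega>. n j \<omega> \<in> upper_half_plane"
    and "layer_params_valid (S j)" and "layer_params_valid (T j)"
    and "\<forall>\<omega>\<in>I. n j \<omega> \<noteq> 0"
    and "\<exists>\<omega>\<^sub>0 \<in> I - {0}. Im (n' j \<omega>\<^sub>0) > 0 \<and>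
           (nu (S j) \<omega>\<^sub>0, nu' (S j) \<omega>\<^sub>0) \<noteq> (n j \<omega>\<^sub>0, n' j \<omega>\<^sub>0)"
    and "\<forall>\<omega>\<in>I. \<forall>\<delta>. layer_data c (n j) (n' j) (S j) \<omega> \<delta> = layer_data c (n j) (n' j) (T j) \<omega> \<delta>"
    and "Zc (S j) < zeta (S j)" and "Zc (T j) < zeta (T j)"
    and "Zc' (S j) > zeta' (S j)" and "zeta' (S j) > 0"
    and "Zc' (T j) > zeta' (T j)" and "zeta' (T j) > 0"
    and "\<exists>\<omega>\<^sub>1 \<in> I - {0}. n' j \<omega>\<^sub>1 / n j \<omega>\<^sub>1 \<noteq> nu' (S j) \<omega>\<^sub>1 / nu (S j) \<omega>\<^sub>1"
  shows "rho (S j) = rho (T j)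
    \<and> zeta (S j) = zeta (T j) \<and> zeta' (S j) = zeta' (T j)
    \<and> Zc (S j) = Zc (T j) \<and> Zc' (S j) = Zc' (T j)
    \<and> (\<forall>\<omega>\<in>I - {0}. nu (S j) \<omega> = nu (T j) \<omega> \<and> nu' (S j) \<omega> = nu' (T j) \<omega>)"
proof -
  let ?S = "S j" and ?T = "T j" and ?n = "n j" and ?n' = "n' j"
  define \<kappa> where "\<kappa> \<omega> = - \<i> * complex_of_real (\<omega> / (2 * c))" for \<omega>
  define p where "p R \<omega> = amplitude (rho R) (nu R \<omega>) (nu' R \<omega>) (?n \<omega>) (?n' \<omega>)"
    for R :: layer_params and \<omega>
  define A where "A R = (zeta R + 3 * Zc R, zeta' R + 3 * Zc' R)" for R :: layer_params
  define B where "B R = (3 * zeta R + Zc R, 3 * zeta' R + Zc' R)" for R :: layer_params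
  have \<kappa>_nz: "\<kappa> \<omega> \<noteq> 0" if "\<omega> \<noteq> 0" for \<omega>
    using that \<open>c > 0\<close> by (simp add: \<kappa>_def)
  have rho: "rho ?S \<noteq> 0"
    and uhp: "nu ?S \<omega> \<in> upper_half_plane" "nu ?T \<omega> \<in> upper_half_plane" "?n \<omega> \<in> upper_half_plane" for \<omega>
    using assms(3-5) by (auto simp: layer_params_valid_def)
  have slope: "snd (A ?S) > snd (B ?S)" "snd (A ?T) > snd (B ?T)"
    using assms(11,13) by (simp_all add: A_def B_def)
  have data: "poly (p ?S \<omega>) (of_real \<delta>) *
        (exp (poly (phase (\<kappa> \<omega>) (?n \<omega>) (?n' \<omega>) (A ?S)) (of_real \<delta>))
       - exp (poly (phase (\<kappa> \<omega>) (?n \<omega>) (?n' \<omega>) (B ?S)) (of_real \<delta>)))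
     = poly (p ?T \<omega>) (of_real \<delta>) *
        (exp (poly (phase (\<kappa> \<omega>) (?n \<omega>) (?n' \<omega>) (A ?T)) (of_real \<delta>))
       - exp (poly (phase (\<kappa> \<omega>) (?n \<omega>) (?n' \<omega>) (B ?T)) (of_real \<delta>)))"
    if "\<omega> \<in> I" for \<omega> \<delta>
    using assms(8) that unfolding layer_data_eq_exp_poly Let_def p_def A_def B_def \<kappa>_def by blast

  obtain \<omega>\<^sub>0 where \<omega>\<^sub>0: "\<omega>\<^sub>0 \<in> I" "\<omega>\<^sub>0 \<noteq> 0" "Im (?n' \<omega>\<^sub>0) > 0"
      "(nu ?S \<omega>\<^sub>0, nu' ?S \<omega>\<^sub>0) \<noteq> (?n \<omega>\<^sub>0, ?n' \<omega>\<^sub>0)"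
    using assms(7) by blast
  have n'_nz: "?n' \<omega>\<^sub>0 \<noteq> 0"
    using \<omega>\<^sub>0(3) by auto
  have p_nz: "p ?S \<omega>\<^sub>0 \<noteq> 0"
    unfolding p_def using amplitude_nonzero[OF rho uhp(1) uhp(3) \<omega>\<^sub>0(4)] .
  have AB: "A ?S = A ?T" "B ?S = B ?T"
    using exponents_determined[OF \<kappa>_nz[OF \<omega>\<^sub>0(2)] n'_nz p_nz slope data[OF \<omega>\<^sub>0(1)]] by blast+

  have amp: "p ?S \<omega> = p ?T \<omega>" if "\<omega> \<in> I - {0}" for \<omega>
  proof (rule amplitude_determined)
    show "\<kappa> \<omega> \<noteq> 0" "?n \<omega> \<noteq> 0" "snd (A ?S) \<noteq> snd (B ?S)"
      using that \<kappa>_nz assms(6) slope by auto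
  qed (use data[of \<omega>] that AB in auto)

  obtain \<omega>\<^sub>1 where \<omega>\<^sub>1: "\<omega>\<^sub>1 \<in> I - {0}" "?n' \<omega>\<^sub>1 / ?n \<omega>\<^sub>1 \<noteq> nu' ?S \<omega>\<^sub>1 / nu ?S \<omega>\<^sub>1"
    using assms(15) by blast
  have "nu ?S \<omega>\<^sub>1 * ?n' \<omega>\<^sub>1 \<noteq> ?n \<omega>\<^sub>1 * nu' ?S \<omega>\<^sub>1"
    using \<omega>\<^sub>1(2) upper_half_plane_nonzero[OF uhp(1)] upper_half_plane_nonzero[OF uhp(3)]
    by (auto simp: frac_eq_eq mult.commute)
  then have rho_eq: "rho ?S = rho ?T"
    using density_determined[OF amp[OF \<omega>\<^sub>1(1), unfolded p_def] rho] by blast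

  have "nu ?S \<omega> = nu ?T \<omega> \<and> nu' ?S \<omega> = nu' ?T \<omega>" if "\<omega> \<in> I - {0}" for \<omega>
  proof -
    have "(nu ?S \<omega>)\<^sup>2 = (nu ?T \<omega>)\<^sup>2" "nu ?S \<omega> * nu' ?S \<omega> = nu ?T \<omega> * nu' ?T \<omega>"
      using amp[OF that] rho unfolding p_def amplitude_eq_iff rho_eq by auto
    then show ?thesis
      using affine_square_determined uhp by blast
  qed
  then show ?thesis
    using AB rho_eq by (auto simp: A_def B_def)
qed

end
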